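(* Let $(\Delta,G,\omega,\zeta)$ be a generalised voltage graph where $\zeta$ is $T$-normalised for some spanning tree $T$ of $\Delta$, i.e. $\zeta(x)=1_G$ for every $x\in D(T)$. Let $A= \langle \zeta(x) \mid x \in D(\Delta) \setminus D(T) \rangle$ and let $B= \langle \omega(v) \mid v \in V(\Delta) \rangle$. Then $\mathrm{GenCov}(\Delta,G,\omega,\zeta)$ is connected if and only if $G = \langle A, B \rangle$.
   Context: Graphs. A graph is a quadruple $(V,D,\mathrm{beg},\mathrm{inv})$ where $V$ is a non-empty set of vertices, $D$ is a set of darts (disjoint from $V$), $\mathrm{beg}\colon D\to V$, and $\mathrm{inv}\colon D\to D$ satisfies $\mathrm{inv}\,\mathrm{inv}\,x=x$ for all $x\in D$. For $\Gamma=(V,D,\mathrm{beg},\mathrm{inv})$ write $V(\Gamma)=V$, $D(\Gamma)=D$, $\mathrm{beg}_\Gamma=\mathrm{beg}$, $\mathrm{inv}_\Gamma=\mathrm{inv}$; also $x^{-1}:=\mathrm{inv}\,x$ and $\mathrm{end}\,x:=\mathrm{beg}\,x^{-1}$. A walk is a sequence of darts $(x_1,\dots,x_n)$ with $\mathrm{end}\,x_i=\mathrm{beg}\,x_{i+1}$; a walk of length $0$ is regarded as a walk from any vertex to itself. A graph is connected if for any two vertices $u,v$ there is a walk from $u$ to $v$. A subgraph has a subset of the vertices and a subset of the darts, with $\mathrm{beg}$ and $\mathrm{inv}$ restricted; it is spanning if it contains all vertices. A tree is a connected graph with no cycles (in the usual sense; in particular it has no semi-edges $x=x^{-1}$, no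 loops and no parallel edges). A spanning tree is a spanning subgraph that is a tree. Generalised voltage graphs. For a group $G$, $S(G)$ is the set of all subgroups of $G$, and $g^h:=h^{-1}gh$, $H^h:=h^{-1}Hh$. A generalised voltage graph is a quadruple $(\Delta,G,\omega,\zeta)$ where $\Delta$ is a connected graph, $G$ is a group, and $\omega\colon V(\Delta)\cup D(\Delta)\to S(G)$ and $\zeta\colon D(\Delta)\to G$ satisfy, for all $x\in D(\Delta)$: $\omega(x)\le\omega(\mathrm{beg}_\Delta x)$; $\omega(x)=\omega(x^{-1})^{\zeta(x)}$; and $\zeta(x^{-1})\zeta(x)\in\omega(x)$. Generalised cover. $\mathrm{GenCov}(\Delta,G,\omega,\zeta)$ is the graph $\Gamma$ with $V(\Gamma)=\{(v,\omega(v)g): v\in V(\Delta), g\in G\}$, $D(\Gamma)=\{(x,\omega(x)g): x\in D(\Delta), g\in G\}$, $\mathrm{beg}_\Gamma(x,\omega(x)g)=(\mathrm{beg}_\Delta x,\omega(\mathrm{beg}_\Delta x)g)$ and $\mathrm{inv}_\Gamma(x,\omega(x)g)=(x^{-1},\omega(x^{-1})\zeta(x)g)$ (right cosets). $\langle\,\cdot\,\rangle$ denotes the subgroup of $G$ generated by the listed elements and subgroups. *)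

theory Defs
  imports "HOL-Algebra.Generated_Groups"
begin

section \<open>Graphs with darts\<close>

text \<open>
  Vertices and darts live in two different types, so the vertex set and the dart set are
  disjoint by construction.  Semi-edges (darts fixed by the involution), loops and parallel
  edges are all allowed.
\<close>

record ('v, 'd) dart_graph =
  verts :: "'v set"
  darts :: "'d set"
  dbeg :: "'d \<Rightarrow> 'v"
  dinv :: "'d \<Rightarrow> 'd"

definition dend :: "('v, 'd) dart_graph \<Rightarrow> 'd \<Rightarrow> 'v" where
  "dend \<Gamma> x = dbeg \<Gamma> (dinv \<Gamma> x)"

locale dart_graph =
  fixes \<Gamma> :: "('v, 'd) dart_graph"
  assumes verts_nonempty: "verts \<Gamma> \<noteq> {}"
    and dbeg_in_verts: "x \<in> darts \<Gamma> \<Longrightarrow> dbeg \<Gamma> x \<in> verts \<Gamma>"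
    and dinv_in_darts: "x \<in> darts \<Gamma> \<Longrightarrow> dinv \<Gamma> x \<in> darts \<Gamma>"
    and dinv_dinv: "x \<in> darts \<Gamma> \<Longrightarrow> dinv \<Gamma> (dinv \<Gamma> x) = x"

definition walk :: "('v, 'd) dart_graph \<Rightarrow> 'd list \<Rightarrow> bool" where
  "walk \<Gamma> xs \<longleftrightarrow> set xs \<subseteq> darts \<Gamma> \<and>
     (\<forall>i. Suc i < length xs \<longrightarrow> dend \<Gamma> (xs ! i) = dbeg \<Gamma> (xs ! Suc i))"

definition walk_from_to :: "('v, 'd) dart_graph \<Rightarrow> 'v \<Rightarrow> 'd list \<Rightarrow> 'v \<Rightarrow> bool" where
  "walk_from_to \<Gamma> u xs v \<longleftrightarrow> u \<in> verts \<Gamma> \<and> v \<in> verts \<Gamma> \<and> walk \<Gamma> xs \<and>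
     (if xs = [] then u = v else dbeg \<Gamma> (hd xs) = u \<and> dend \<Gamma> (last xs) = v)"

definition connected_graph :: "('v, 'd) dart_graph \<Rightarrow> bool" where
  "connected_graph \<Gamma> \<longleftrightarrow> (\<forall>u\<in>verts \<Gamma>. \<forall>v\<in>verts \<Gamma>. \<exists>xs. walk_from_to \<Gamma> u xs v)"

text \<open>
  A cycle is a non-empty closed walk without repeated vertices that does not use both a dart and
  its inverse at different positions.  The last condition matters only for length two, where it
  separates a pair of parallel edges from one edge traversed back and forth.  A single loop
  dart, or a single semi-edge, is a cycle of length one.
\<close>

definition cycle :: "('v, 'd) dart_graph \<Rightarrow> 'd list \<Rightarrow> bool" where
  "cycle \<Gamma> xs \<longleftrightarrow> xs \<noteq> [] \<and> walk \<Gamma> xs \<and> dend \<Gamma> (last xs) = dbeg \<Gamma> (hd xs) \<and>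
     distinct (map (dbeg \<Gamma>) xs) \<and>
     (\<forall>i<length xs. \<forall>j<length xs. i \<noteq> j \<longrightarrow> xs ! j \<noteq> dinv \<Gamma> (xs ! i))"

definition tree :: "('v, 'd) dart_graph \<Rightarrow> bool" where
  "tree \<Gamma> \<longleftrightarrow> dart_graph \<Gamma> \<and> connected_graph \<Gamma> \<and> (\<nexists>xs. cycle \<Gamma> xs)"

definition subgraph :: "('v, 'd) dart_graph \<Rightarrow> ('v, 'd) dart_graph \<Rightarrow> bool" where
  "subgraph \<Gamma>' \<Gamma> \<longleftrightarrow> dart_graph \<Gamma>' \<and> verts \<Gamma>' \<subseteq> verts \<Gamma> \<and> darts \<Gamma>' \<subseteq> darts \<Gamma> \<and>
     (\<forall>x\<in>darts \<Gamma>'. dbeg \<Gamma>' x = dbeg \<Gamma> x \<and> dinv \<Gamma>' x = dinv \<Gamma> x)"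

definition spanning_tree :: "('v, 'd) dart_graph \<Rightarrow> ('v, 'd) dart_graph \<Rightarrow> bool" where
  "spanning_tree T \<Gamma> \<longleftrightarrow> subgraph T \<Gamma> \<and> verts T = verts \<Gamma> \<and> tree T"

lemma tree_no_loop:
  assumes "tree \<Gamma>" "x \<in> darts \<Gamma>"
  shows "dend \<Gamma> x \<noteq> dbeg \<Gamma> x"
proof
  assume "dend \<Gamma> x = dbeg \<Gamma> x"
  then have "cycle \<Gamma> [x]"
    using assms(2) by (simp add: cycle_def walk_def)
  then show False
    using assms(1) by (auto simp: tree_def)
qed

lemma tree_no_semi_edge:
  assumes "tree \<Gamma>" "x \<in> darts \<Gamma>"
  shows "dinv \<Gamma> x \<noteq> x"
  using tree_no_loop[OF assms] by (auto simp: dend_def)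

lemma tree_no_parallel_edges:
  assumes "tree \<Gamma>" "x \<in> darts \<Gamma>" "y \<in> darts \<Gamma>"
    and ends: "dbeg \<Gamma> x = dbeg \<Gamma> y" "dend \<Gamma> x = dend \<Gamma> y"
  shows "x = y"
proof (rule ccontr)
  assume "x \<noteq> y"
  interpret dart_graph \<Gamma> using assms(1) by (simp add: tree_def)
  let ?z = "dinv \<Gamma> y"
  have z: "?z \<in> darts \<Gamma>" "dinv \<Gamma> ?z = y"
    using dinv_in_darts dinv_dinv assms(3) by auto
  have "?z \<noteq> dinv \<Gamma> x"
    using \<open>x \<noteq> y\<close> dinv_dinv assms(2,3) by metis
  moreover have "dbeg \<Gamma> x \<noteq> dbeg \<Gamma> ?z"
    using tree_no_loop[OF assms(1,3)] ends by (simp add: dend_def)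
  ultimately have "cycle \<Gamma> [x, ?z]"
    using z assms(2) ends \<open>x \<noteq> y\<close>
    by (auto simp: cycle_def walk_def dend_def less_Suc_eq nth_Cons')
  then show False
    using assms(1) by (auto simp: tree_def)
qed


section \<open>Generalised voltage graphs\<close>

text \<open>
  The weight function \<open>\<omega>\<close> on vertices and darts is a function on the sum type:
  \<open>\<omega> (Inl v)\<close> is the subgroup at a vertex and \<open>\<omega> (Inr x)\<close> the subgroup at a dart.
\<close>

locale gen_voltage_graph =
  dart_graph \<Delta> + group G
  for \<Delta> :: "('v, 'd) dart_graph"
    and G :: "('g, 'm) monoid_scheme" (structure)
    and \<omega> :: "'v + 'd \<Rightarrow> 'g set"
    and \<zeta> :: "'d \<Rightarrow> 'g" +
  assumes base_connected: "connected_graph \<Delta>"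
    and vertex_weight: "v \<in> verts \<Delta> \<Longrightarrow> subgroup (\<omega> (Inl v)) G"
    and dart_weight: "x \<in> darts \<Delta> \<Longrightarrow> subgroup (\<omega> (Inr x)) G"
    and voltage_closed: "x \<in> darts \<Delta> \<Longrightarrow> \<zeta> x \<in> carrier G"
    and weight_le: "x \<in> darts \<Delta> \<Longrightarrow> \<omega> (Inr x) \<subseteq> \<omega> (Inl (dbeg \<Delta> x))"
    and weight_conj: "x \<in> darts \<Delta> \<Longrightarrow>
          \<omega> (Inr x) = inv (\<zeta> x) <# (\<omega> (Inr (dinv \<Delta> x)) #> \<zeta> x)"
    and voltage_dinv: "x \<in> darts \<Delta> \<Longrightarrow> \<zeta> (dinv \<Delta> x) \<otimes> \<zeta> x \<in> \<omega> (Inr x)"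

definition normalised ::
  "('v, 'd) dart_graph \<Rightarrow> ('g, 'm) monoid_scheme \<Rightarrow> ('d \<Rightarrow> 'g) \<Rightarrow> bool" where
  "normalised T G \<zeta> \<longleftrightarrow> (\<forall>x\<in>darts T. \<zeta> x = \<one>\<^bsub>G\<^esub>)"

text \<open>
  The maps of the cover are specified on representatives of cosets.  To have them as functions of
  the coset \<open>C = \<omega>(x)g\<close> itself, we use the set products
  \<open>\<omega>(beg x) C = \<omega>(beg x) g\<close> and \<open>\<omega>(x\<inverse>) \<zeta>(x) C = \<omega>(x\<inverse>) \<zeta>(x) g\<close>.  The lemmas
  \<open>dbeg_gen_cov\<close> and \<open>dinv_gen_cov\<close> below give the description by representatives.
\<close>

definition gen_cov ::
  "('v, 'd) dart_graph \<Rightarrow> ('g, 'm) monoid_scheme \<Rightarrow> ('v + 'd \<Rightarrow> 'g set) \<Rightarrow> ('d \<Rightarrow> 'g) \<Rightarrow>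
   ('v \<times> 'g set, 'd \<times> 'g set) dart_graph" where
  "gen_cov \<Delta> G \<omega> \<zeta> =
    \<lparr> verts = {(v, \<omega> (Inl v) #>\<^bsub>G\<^esub> g) | v g. v \<in> verts \<Delta> \<and> g \<in> carrier G},
      darts = {(x, \<omega> (Inr x) #>\<^bsub>G\<^esub> g) | x g. x \<in> darts \<Delta> \<and> g \<in> carrier G},
      dbeg = (\<lambda>(x, C). (dbeg \<Delta> x, \<omega> (Inl (dbeg \<Delta> x)) <#>\<^bsub>G\<^esub> C)),
      dinv = (\<lambda>(x, C). (dinv \<Delta> x, (\<omega> (Inr (dinv \<Delta> x)) #>\<^bsub>G\<^esub> \<zeta> x) <#>\<^bsub>G\<^esub> C)) \<rparr>"

context gen_voltage_graph
begin

lemma vertex_weight_closed: "v \<in> verts \<Delta> \<Longrightarrow> \<omega> (Inl v) \<subseteq> carrier G"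
  using vertex_weight subgroup.subset by blast

lemma dart_weight_closed: "x \<in> darts \<Delta> \<Longrightarrow> \<omega> (Inr x) \<subseteq> carrier G"
  using dart_weight subgroup.subset by blast

lemma dbeg_gen_cov:
  assumes x: "x \<in> darts \<Delta>" and g: "g \<in> carrier G"
  shows "dbeg (gen_cov \<Delta> G \<omega> \<zeta>) (x, \<omega> (Inr x) #> g) = (dbeg \<Delta> x, \<omega> (Inl (dbeg \<Delta> x)) #> g)"
proof -
  have v: "subgroup (\<omega> (Inl (dbeg \<Delta> x))) G"
    using x dbeg_in_verts vertex_weight by blast
  have "\<omega> (Inl (dbeg \<Delta> x)) <#> \<omega> (Inr x) = \<omega> (Inl (dbeg \<Delta> x))"
  proof
    show "\<omega> (Inl (dbeg \<Delta> x)) <#> \<omega> (Inr x) \<subseteq> \<omega> (Inl (dbeg \<Delta> x))"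
      using weight_le[OF x] subgroup.m_closed[OF v] by (auto simp: set_mult_def)
    show "\<omega> (Inl (dbeg \<Delta> x)) \<subseteq> \<omega> (Inl (dbeg \<Delta> x)) <#> \<omega> (Inr x)"
    proof
      fix h assume h: "h \<in> \<omega> (Inl (dbeg \<Delta> x))"
      then have "h = h \<otimes> \<one>" using subgroup.mem_carrier[OF v] by simp
      then show "h \<in> \<omega> (Inl (dbeg \<Delta> x)) <#> \<omega> (Inr x)"
        using h subgroup.one_closed[OF dart_weight[OF x]] unfolding set_mult_def by blast
    qed
  qed
  then show ?thesis
    using setmult_rcos_assoc[OF subgroup.subset[OF v] dart_weight_closed[OF x] g]
    by (simp add: gen_cov_def)
qed

lemma weight_swap:
  assumes x: "x \<in> darts \<Delta>"
  shows "\<omega> (Inr (dinv \<Delta> x)) #> \<zeta> x = \<zeta> x <# \<omega> (Inr x)"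
proof -
  have c: "\<zeta> x \<in> carrier G" "\<omega> (Inr (dinv \<Delta> x)) #> \<zeta> x \<subseteq> carrier G"
    using x voltage_closed dinv_in_darts dart_weight_closed r_coset_subset_G by auto
  have "\<zeta> x <# \<omega> (Inr x) = \<zeta> x <# (inv (\<zeta> x) <# (\<omega> (Inr (dinv \<Delta> x)) #> \<zeta> x))"
    using weight_conj[OF x] by simp
  also have "\<dots> = \<omega> (Inr (dinv \<Delta> x)) #> \<zeta> x"
    using c by (simp add: lcos_m_assoc lcos_mult_one)
  finally show ?thesis by simp
qed

lemma dinv_gen_cov:
  assumes x: "x \<in> darts \<Delta>" and g: "g \<in> carrier G"
  shows "dinv (gen_cov \<Delta> G \<omega> \<zeta>) (x, \<omega> (Inr x) #> g) =
         (dinv \<Delta> x, \<omega> (Inr (dinv \<Delta> x)) #> (\<zeta> x \<otimes> g))"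
proof -
  have c: "\<zeta> x \<in> carrier G" "\<omega> (Inr x) \<subseteq> carrier G" "\<omega> (Inr (dinv \<Delta> x)) \<subseteq> carrier G"
    using x voltage_closed dinv_in_darts dart_weight_closed by auto
  have "(\<zeta> x <# \<omega> (Inr x)) <#> (\<omega> (Inr x) #> g) = (\<zeta> x <# \<omega> (Inr x)) <#> \<omega> (Inr x) #> g"
    using c g by (simp add: setmult_rcos_assoc l_coset_subset_G)
  also have "(\<zeta> x <# \<omega> (Inr x)) <#> \<omega> (Inr x) = \<zeta> x <# \<omega> (Inr x)"
    using c subgroup_mult_id[OF dart_weight[OF x]]
    by (simp add: l_coset_eq_set_mult set_mult_assoc)
  finally have "(\<omega> (Inr (dinv \<Delta> x)) #> \<zeta> x) <#> (\<omega> (Inr x) #> g) =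
      \<omega> (Inr (dinv \<Delta> x)) #> \<zeta> x #> g"
    by (simp add: weight_swap[OF x])
  then show ?thesis
    using c g by (simp add: gen_cov_def coset_mult_assoc)
qed

lemma dart_graph_gen_cov: "dart_graph (gen_cov \<Delta> G \<omega> \<zeta>)"
proof (rule dart_graph.intro)
  let ?C = "gen_cov \<Delta> G \<omega> \<zeta>"
  show "verts ?C \<noteq> {}"
    using verts_nonempty one_closed by (fastforce simp: gen_cov_def)
  fix y assume "y \<in> darts ?C"
  then obtain x g where y: "y = (x, \<omega> (Inr x) #> g)" and x: "x \<in> darts \<Delta>" and g: "g \<in> carrier G"
    by (auto simp: gen_cov_def)
  let ?x = "dinv \<Delta> x"
  have x': "?x \<in> darts \<Delta>" "dinv \<Delta> ?x = x"
    using x dinv_in_darts dinv_dinv by auto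
  have c: "\<zeta> x \<in> carrier G" "\<zeta> ?x \<in> carrier G"
    using x x' voltage_closed by auto
  show "dbeg ?C y \<in> verts ?C"
    unfolding y dbeg_gen_cov[OF x g] using x g dbeg_in_verts by (auto simp: gen_cov_def)
  have eq: "dinv ?C y = (?x, \<omega> (Inr ?x) #> (\<zeta> x \<otimes> g))"
    unfolding y by (rule dinv_gen_cov[OF x g])
  show "dinv ?C y \<in> darts ?C"
    unfolding eq using x' c g by (auto simp: gen_cov_def)
  have "dinv ?C (dinv ?C y) = (x, \<omega> (Inr x) #> (\<zeta> ?x \<otimes> (\<zeta> x \<otimes> g)))"
    unfolding eq using dinv_gen_cov[OF x'(1), of "\<zeta> x \<otimes> g"] c g x' by simp
  also have "\<omega> (Inr x) #> (\<zeta> ?x \<otimes> (\<zeta> x \<otimes> g)) = \<omega> (Inr x) #> (\<zeta> ?x \<otimes> \<zeta> x) #> g"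
    using c g dart_weight_closed[OF x] by (simp add: coset_mult_assoc m_assoc)
  also have "\<omega> (Inr x) #> (\<zeta> ?x \<otimes> \<zeta> x) = \<omega> (Inr x)"
    using c voltage_dinv[OF x] dart_weight[OF x] by (simp add: coset_join2)
  finally show "dinv ?C (dinv ?C y) = y"
    by (simp add: y)
qed

end

end

(* Write (v, g) for the vertex (v, \<omega>(v)g) of the cover. Every dart x of \<Delta> joins (beg x, g) to
   (end x, \<zeta>(x)g). Hence the vertices (v, g) with g in \<langle>A, B\<rangle> are closed under adjacency, so
   connectedness forces G = \<langle>A, B\<rangle>. Conversely, right multiplication acts on the cover by
   automorphisms and, the voltages on T being trivial, the tree lifts to a path from (v, g) to (w, g)
   for all v, w and g; so the elements k with (v, 1) and (v, k) in the same component for every v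
   form a subgroup of G, which contains all voltages and all vertex weights. *)
theory Submission
  imports Defs
begin

section \<open>Walks and the adjacency relation of a graph\<close>

definition adj :: "('v, 'd) dart_graph \<Rightarrow> 'v rel" where
  "adj \<Gamma> = {(dbeg \<Gamma> x, dend \<Gamma> x) | x. x \<in> darts \<Gamma>}"

lemma walk_Nil [simp]: "walk \<Gamma> []"
  by (simp add: walk_def)

lemma walk_Cons:
  "walk \<Gamma> (x # xs) \<longleftrightarrow> x \<in> darts \<Gamma> \<and> walk \<Gamma> xs \<and> (xs \<noteq> [] \<longrightarrow> dend \<Gamma> x = dbeg \<Gamma> (hd xs))"
proof (cases xs)
  case Nil
  then show ?thesis by (simp add: walk_def)
next
  case (Cons y ys)
  have "(\<forall>i. Suc i < length (x # xs) \<longrightarrow> dend \<Gamma> ((x # xs) ! i) = dbeg \<Gamma> ((x # xs) ! Suc i)) \<longleftrightarrow>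
      dend \<Gamma> x = dbeg \<Gamma> y \<and> (\<forall>i. Suc i < length xs \<longrightarrow> dend \<Gamma> (xs ! i) = dbeg \<Gamma> (xs ! Suc i))"
    using Cons by (auto simp: nth_Cons split: nat.splits)
  then show ?thesis
    using Cons by (auto simp: walk_def)
qed

context dart_graph
begin

lemma dend_in_verts: "x \<in> darts \<Gamma> \<Longrightarrow> dend \<Gamma> x \<in> verts \<Gamma>"
  by (simp add: dend_def dbeg_in_verts dinv_in_darts)

lemma walk_from_to_Cons:
  "walk_from_to \<Gamma> u (x # xs) v \<longleftrightarrow>
    x \<in> darts \<Gamma> \<and> dbeg \<Gamma> x = u \<and> walk_from_to \<Gamma> (dend \<Gamma> x) xs v"
  by (cases xs) (auto simp: walk_from_to_def walk_Cons dbeg_in_verts dend_in_verts)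

lemma sym_adj: "sym (adj \<Gamma>)"
proof (rule symI)
  fix u v assume "(u, v) \<in> adj \<Gamma>"
  then obtain x where x: "x \<in> darts \<Gamma>" and "u = dbeg \<Gamma> x" "v = dend \<Gamma> x"
    by (auto simp: adj_def)
  then have "v = dbeg \<Gamma> (dinv \<Gamma> x)" "u = dend \<Gamma> (dinv \<Gamma> x)"
    by (simp_all add: dend_def dinv_dinv)
  then show "(v, u) \<in> adj \<Gamma>"
    using dinv_in_darts[OF x] by (auto simp: adj_def)
qed

text \<open>Trades walks for chains of adjacencies, so that joining and reversing walks become
  transitivity and symmetry of a relation. The closure is reflexive also outside
  \<open>verts \<Gamma>\<close>, where no walk exists; hence the two assumptions.\<close>

lemma ex_walk_iff_rtrancl_adj:
  assumes "u \<in> verts \<Gamma>" "v \<in> verts \<Gamma>"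
  shows "(\<exists>xs. walk_from_to \<Gamma> u xs v) \<longleftrightarrow> (u, v) \<in> (adj \<Gamma>)\<^sup>*"
proof
  assume "\<exists>xs. walk_from_to \<Gamma> u xs v"
  then obtain xs where "walk_from_to \<Gamma> u xs v" ..
  then show "(u, v) \<in> (adj \<Gamma>)\<^sup>*"
  proof (induction xs arbitrary: u)
    case Nil
    then show ?case by (simp add: walk_from_to_def)
  next
    case (Cons x xs)
    then have "(u, dend \<Gamma> x) \<in> adj \<Gamma>" "(dend \<Gamma> x, v) \<in> (adj \<Gamma>)\<^sup>*"
      by (auto simp: walk_from_to_Cons adj_def)
    then show ?case by (rule converse_rtrancl_into_rtrancl)
  qed
next
  assume "(u, v) \<in> (adj \<Gamma>)\<^sup>*"
  then show "\<exists>xs. walk_from_to \<Gamma> u xs v"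
  proof (induction rule: converse_rtrancl_induct)
    case base
    then have "walk_from_to \<Gamma> v [] v"
      using assms by (simp add: walk_from_to_def)
    then show ?case ..
  next
    case (step u w)
    then obtain x xs where "x \<in> darts \<Gamma>" "u = dbeg \<Gamma> x" "w = dend \<Gamma> x" "walk_from_to \<Gamma> w xs v"
      by (auto simp: adj_def)
    then have "walk_from_to \<Gamma> u (x # xs) v"
      by (simp add: walk_from_to_Cons)
    then show ?case ..
  qed
qed

lemma connected_graph_iff_rtrancl_adj:
  "connected_graph \<Gamma> \<longleftrightarrow> (\<forall>u\<in>verts \<Gamma>. \<forall>v\<in>verts \<Gamma>. (u, v) \<in> (adj \<Gamma>)\<^sup>*)"
  by (simp add: connected_graph_def ex_walk_iff_rtrancl_adj)

end

text \<open>Turns membership of a representative in \<open>H\<close> into a property of the coset,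
  which no longer depends on the representative chosen.\<close>

lemma (in group) rcos_subset_subgroup_iff:
  assumes "subgroup W G" "subgroup H G" "W \<subseteq> H" "g \<in> carrier G"
  shows "W #> g \<subseteq> H \<longleftrightarrow> g \<in> H"
  using assms rcos_self[of g W] subgroup.m_closed[of H G] by (auto simp: r_coset_def)

section \<open>Adjacency, translations and lifted paths in the cover\<close>

context gen_voltage_graph
begin

abbreviation cover :: "('v \<times> 'g set, 'd \<times> 'g set) dart_graph" where
  "cover \<equiv> gen_cov \<Delta> G \<omega> \<zeta>"

abbreviation cov_vert :: "'v \<Rightarrow> 'g \<Rightarrow> 'v \<times> 'g set" where
  "cov_vert v g \<equiv> (v, \<omega> (Inl v) #> g)"

lemma dend_gen_cov:
  assumes "x \<in> darts \<Delta>" "g \<in> carrier G"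
  shows "dend cover (x, \<omega> (Inr x) #> g) = cov_vert (dend \<Delta> x) (\<zeta> x \<otimes> g)"
  using assms dbeg_gen_cov[of "dinv \<Delta> x" "\<zeta> x \<otimes> g"]
  by (simp add: dend_def dinv_gen_cov dinv_in_darts voltage_closed)

text \<open>Removes the dart cosets: from here on an adjacency of the cover is given by a dart of
  \<open>\<Delta>\<close> and a group element.\<close>

lemma adj_gen_cov:
  "adj cover = {(cov_vert (dbeg \<Delta> x) g, cov_vert (dend \<Delta> x) (\<zeta> x \<otimes> g)) | x g.
     x \<in> darts \<Delta> \<and> g \<in> carrier G}"
proof -
  have "adj cover = {(dbeg cover (x, \<omega> (Inr x) #> g), dend cover (x, \<omega> (Inr x) #> g)) | x g.
     x \<in> darts \<Delta> \<and> g \<in> carrier G}"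
    unfolding adj_def by (auto simp: gen_cov_def)
  also have "\<dots> = {(cov_vert (dbeg \<Delta> x) g, cov_vert (dend \<Delta> x) (\<zeta> x \<otimes> g)) | x g.
     x \<in> darts \<Delta> \<and> g \<in> carrier G}"
    by (rule Collect_cong) (metis dbeg_gen_cov dend_gen_cov)
  finally show ?thesis .
qed

lemma verts_gen_cov: "verts cover = {cov_vert v g | v g. v \<in> verts \<Delta> \<and> g \<in> carrier G}"
  by (simp add: gen_cov_def)

lemma connected_gen_cov_iff:
  "connected_graph cover \<longleftrightarrow>
    (\<forall>v\<in>verts \<Delta>. \<forall>w\<in>verts \<Delta>. \<forall>g\<in>carrier G. \<forall>h\<in>carrier G.
      (cov_vert v g, cov_vert w h) \<in> (adj cover)\<^sup>*)"
  unfolding dart_graph.connected_graph_iff_rtrancl_adj[OF dart_graph_gen_cov] verts_gen_cov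
  by blast

lemma rtrancl_adj_gen_cov_sym:
  "(P, Q) \<in> (adj cover)\<^sup>* \<Longrightarrow> (Q, P) \<in> (adj cover)\<^sup>*"
  using dart_graph.sym_adj[OF dart_graph_gen_cov] by (meson sym_rtrancl symD)

text \<open>Right multiplication by \<open>k\<close> commutes with left multiplication by voltages.
  It is applied to pairs through \<open>apsnd\<close> because the inner vertices of a chain come
  without chosen representatives.\<close>

lemma adj_gen_cov_translate:
  assumes "(P, Q) \<in> adj cover" "k \<in> carrier G"
  shows "(apsnd (\<lambda>C. C #> k) P, apsnd (\<lambda>C. C #> k) Q) \<in> adj cover"
proof -
  obtain x g where x: "x \<in> darts \<Delta>" and g: "g \<in> carrier G"
    and P: "P = cov_vert (dbeg \<Delta> x) g" and Q: "Q = cov_vert (dend \<Delta> x) (\<zeta> x \<otimes> g)"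
    using assms(1) unfolding adj_gen_cov by blast
  have "apsnd (\<lambda>C. C #> k) P = cov_vert (dbeg \<Delta> x) (g \<otimes> k)"
    using x g assms(2) by (simp add: P coset_mult_assoc vertex_weight_closed dbeg_in_verts)
  moreover have "apsnd (\<lambda>C. C #> k) Q = cov_vert (dend \<Delta> x) (\<zeta> x \<otimes> (g \<otimes> k))"
    using x g assms(2)
    by (simp add: Q coset_mult_assoc vertex_weight_closed dend_in_verts voltage_closed m_assoc)
  ultimately show ?thesis
    using x g assms(2) unfolding adj_gen_cov by blast
qed

lemma rtrancl_adj_gen_cov_translate:
  assumes "(cov_vert v g, cov_vert w h) \<in> (adj cover)\<^sup>*"
    and "v \<in> verts \<Delta>" "w \<in> verts \<Delta>" "g \<in> carrier G" "h \<in> carrier G" "k \<in> carrier G"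
  shows "(cov_vert v (g \<otimes> k), cov_vert w (h \<otimes> k)) \<in> (adj cover)\<^sup>*"
proof -
  have "(apsnd (\<lambda>C. C #> k) (cov_vert v g), apsnd (\<lambda>C. C #> k) (cov_vert w h)) \<in> (adj cover)\<^sup>*"
    using assms(1)
  proof (induction rule: rtrancl_induct)
    case (step P Q)
    then show ?case using adj_gen_cov_translate[OF _ assms(6)] by (meson rtrancl.rtrancl_into_rtrancl)
  qed simp
  then show ?thesis
    using assms by (simp add: coset_mult_assoc vertex_weight_closed)
qed

text \<open>Each adjacency multiplies a representative on the left by a voltage, which lies in
  \<open>H\<close>; so lying inside \<open>H\<close> is an invariant of the vertex cosets along a
  chain.\<close>

lemma rtrancl_adj_gen_cov_subset:
  assumes "(P, Q) \<in> (adj cover)\<^sup>*" "snd P \<subseteq> H" and H: "subgroup H G"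
    and weights: "\<And>v. v \<in> verts \<Delta> \<Longrightarrow> \<omega> (Inl v) \<subseteq> H"
    and voltages: "\<And>x. x \<in> darts \<Delta> \<Longrightarrow> \<zeta> x \<in> H"
  shows "snd Q \<subseteq> H"
  using assms(1,2)
proof (induction rule: rtrancl_induct)
  case (step P Q)
  then obtain x g where x: "x \<in> darts \<Delta>" and g: "g \<in> carrier G"
    and P: "P = cov_vert (dbeg \<Delta> x) g" and Q: "Q = cov_vert (dend \<Delta> x) (\<zeta> x \<otimes> g)"
    unfolding adj_gen_cov by blast
  \<comment> \<open>The \<open>g\<close> supplied by the adjacency is an arbitrary representative of
    \<open>P\<close>; containment of the whole coset in \<open>H\<close> still places it in
    \<open>H\<close>.\<close>
  have "g \<in> H"
    using step x g rcos_subset_subgroup_iff[OF vertex_weight H weights]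
    by (auto simp: P dbeg_in_verts)
  then have "\<zeta> x \<otimes> g \<in> H"
    using voltages[OF x] subgroup.m_closed[OF H] by blast
  then show ?case
    using x g rcos_subset_subgroup_iff[OF vertex_weight H weights]
    by (simp add: Q dend_in_verts voltage_closed)
qed

text \<open>A dart of \<open>T\<close> has voltage \<open>\<one>\<close>, so its lift starting at
  representative \<open>g\<close> also ends at representative \<open>g\<close>.\<close>

lemma rtrancl_adj_gen_cov_tree:
  assumes "spanning_tree T \<Delta>" "normalised T G \<zeta>"
    and "v \<in> verts \<Delta>" "w \<in> verts \<Delta>" and g: "g \<in> carrier G"
  shows "(cov_vert v g, cov_vert w g) \<in> (adj cover)\<^sup>*"
proof -
  have "dart_graph T" "connected_graph T" "verts T = verts \<Delta>"
    and T: "\<And>x. x \<in> darts T \<Longrightarrow> x \<in> darts \<Delta> \<and> dbeg T x = dbeg \<Delta> x \<and> dinv T x = dinv \<Delta> x"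
    using assms(1) by (auto simp: spanning_tree_def tree_def subgraph_def)
  then interpret T: dart_graph T by simp
  have "(v, w) \<in> (adj T)\<^sup>*"
    using assms(3,4) \<open>connected_graph T\<close> \<open>verts T = verts \<Delta>\<close>
    by (simp add: T.connected_graph_iff_rtrancl_adj)
  then show ?thesis
  proof (induction rule: rtrancl_induct)
    case (step u w)
    then obtain x where x: "x \<in> darts T" and "u = dbeg T x" "w = dend T x"
      by (auto simp: adj_def)
    \<comment> \<open>\<open>dend\<close> is \<open>dbeg\<close> of the inverse dart, so
      \<open>T\<close> and \<open>\<Delta>\<close> must agree at that dart too; it lies in
      \<open>T\<close> by \<open>T.dinv_in_darts\<close>.\<close>
    then have "x \<in> darts \<Delta>" "u = dbeg \<Delta> x" "w = dend \<Delta> x" "\<zeta> x \<otimes> g = g"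
      using T T.dinv_in_darts g assms(2) by (auto simp: dend_def normalised_def)
    then have "(cov_vert u g, cov_vert w g) \<in> adj cover"
      using g unfolding adj_gen_cov by force
    with step.IH show ?case by (rule rtrancl_into_rtrancl)
  qed simp
qed

section \<open>The stabiliser, under right translation, of the components of all
  \<open>cov_vert v \<one>\<close>\<close>

definition stable_elems :: "'g set" where
  "stable_elems =
    {k \<in> carrier G. \<forall>v\<in>verts \<Delta>. (cov_vert v \<one>, cov_vert v k) \<in> (adj cover)\<^sup>*}"

text \<open>Translating a chain from \<open>\<one>\<close> to \<open>k\<close> by
  \<open>inv k\<close> gives one from \<open>inv k\<close> to \<open>\<one>\<close>, to be reversed;
  translating it by \<open>l\<close> gives one from \<open>l\<close> to
  \<open>k \<otimes> l\<close>, to be appended to a chain from \<open>\<one>\<close> to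
  \<open>l\<close>.\<close>

lemma subgroup_stable_elems: "subgroup stable_elems G"
proof (rule subgroupI)
  show "stable_elems \<subseteq> carrier G"
    by (auto simp: stable_elems_def)
  show "stable_elems \<noteq> {}"
    by (auto simp: stable_elems_def intro!: exI[of _ \<one>])
next
  fix k assume "k \<in> stable_elems"
  then have k: "k \<in> carrier G"
    and reach: "\<And>v. v \<in> verts \<Delta> \<Longrightarrow> (cov_vert v \<one>, cov_vert v k) \<in> (adj cover)\<^sup>*"
    by (auto simp: stable_elems_def)
  have "(cov_vert v \<one>, cov_vert v (inv k)) \<in> (adj cover)\<^sup>*" if v: "v \<in> verts \<Delta>" for v
    using rtrancl_adj_gen_cov_translate[OF reach[OF v] v v, of "inv k"] k
    by (simp add: rtrancl_adj_gen_cov_sym)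
  then show "inv k \<in> stable_elems"
    using k by (simp add: stable_elems_def)
next
  fix k l assume "k \<in> stable_elems" "l \<in> stable_elems"
  then have k: "k \<in> carrier G" and l: "l \<in> carrier G"
    and reach: "\<And>v. v \<in> verts \<Delta> \<Longrightarrow> (cov_vert v \<one>, cov_vert v k) \<in> (adj cover)\<^sup>*"
      "\<And>v. v \<in> verts \<Delta> \<Longrightarrow> (cov_vert v \<one>, cov_vert v l) \<in> (adj cover)\<^sup>*"
    by (auto simp: stable_elems_def)
  have "(cov_vert v \<one>, cov_vert v (k \<otimes> l)) \<in> (adj cover)\<^sup>*" if v: "v \<in> verts \<Delta>" for v
    using rtrancl_adj_gen_cov_translate[OF reach(1)[OF v] v v, of l] reach(2)[OF v] k l
    by (simp add: rtrancl_trans)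
  then show "k \<otimes> l \<in> stable_elems"
    using k l by (simp add: stable_elems_def)
qed

text \<open>One chain, possibly between different fibres, is enough: lifts of tree paths carry
  \<open>u\<close> to \<open>v\<close> at level \<open>\<one>\<close> and \<open>w\<close> back to
  \<open>u\<close> at level \<open>k\<close>.\<close>

lemma stable_elemsI:
  assumes T: "spanning_tree T \<Delta>" "normalised T G \<zeta>"
    and "v \<in> verts \<Delta>" "w \<in> verts \<Delta>" "k \<in> carrier G"
    and reach: "(cov_vert v \<one>, cov_vert w k) \<in> (adj cover)\<^sup>*"
  shows "k \<in> stable_elems"
proof -
  have "(cov_vert u \<one>, cov_vert u k) \<in> (adj cover)\<^sup>*" if "u \<in> verts \<Delta>" for u
    using rtrancl_adj_gen_cov_tree[OF T that, of v \<one>] reach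
      rtrancl_adj_gen_cov_tree[OF T, of w u k] that assms(3-5)
    by (meson one_closed rtrancl_trans)
  then show ?thesis
    using assms(5) by (simp add: stable_elems_def)
qed

section \<open>Connectedness of the cover and generation of the group\<close>

lemma connected_gen_cov_iff_generate:
  assumes T: "spanning_tree T \<Delta>" "normalised T G \<zeta>"
    and A: "A = generate G {\<zeta> x | x. x \<in> darts \<Delta> - darts T}"
    and B: "B = generate G (\<Union>v\<in>verts \<Delta>. \<omega> (Inl v))"
  shows "connected_graph cover \<longleftrightarrow> carrier G = generate G (A \<union> B)"
proof
  have voltages_closed: "{\<zeta> x | x. x \<in> darts \<Delta> - darts T} \<subseteq> carrier G"
    using voltage_closed by auto
  have weights_closed: "(\<Union>v\<in>verts \<Delta>. \<omega> (Inl v)) \<subseteq> carrier G"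
    using vertex_weight_closed by auto
  have "A \<union> B \<subseteq> carrier G"
    using voltages_closed weights_closed generate_incl unfolding A B by blast
  then have H: "subgroup (generate G (A \<union> B)) G"
    by (rule generate_is_subgroup)
  have "\<omega> (Inl v) \<subseteq> generate G (A \<union> B)" if "v \<in> verts \<Delta>" for v
    using that by (auto simp: B intro: generate.incl)
  moreover have "\<zeta> x \<in> generate G (A \<union> B)" if "x \<in> darts \<Delta>" for x
  proof (cases "x \<in> darts T")
    case True
    then show ?thesis
      using T(2) generate.one by (simp add: normalised_def)
  next
    case False
    then have "\<zeta> x \<in> A"
      using that by (auto simp: A intro: generate.incl)
    then show ?thesis by (simp add: generate.incl)
  qed
  moreover assume conn: "connected_graph cover"
  moreover obtain v where v: "v \<in> verts \<Delta>"
    using verts_nonempty by blast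
  \<comment> \<open>The invariant is followed from \<open>cov_vert v \<one>\<close>, whose coset is
    the weight of \<open>v\<close> and lies in the subgroup, to \<open>cov_vert v g\<close>.\<close>
  ultimately have "g \<in> generate G (A \<union> B)" if g: "g \<in> carrier G" for g
    using rtrancl_adj_gen_cov_subset[OF _ _ H, of "cov_vert v \<one>" "cov_vert v g"] g
      rcos_subset_subgroup_iff[OF vertex_weight H, of v]
      subgroup.one_closed[OF H]
    by (simp add: connected_gen_cov_iff)
  then show "carrier G = generate G (A \<union> B)"
    using subgroup.subset[OF H] by blast
next
  have "\<zeta> x \<in> stable_elems" if x: "x \<in> darts \<Delta>" for x
  proof (rule stable_elemsI[OF T dbeg_in_verts dend_in_verts voltage_closed, OF x x x])
    \<comment> \<open>The lift of \<open>x\<close> starting at representative \<open>\<one>\<close>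
      is the required chain between the fibres over its two ends.\<close>
    have "(cov_vert (dbeg \<Delta> x) \<one>, cov_vert (dend \<Delta> x) (\<zeta> x \<otimes> \<one>)) \<in> adj cover"
      using x unfolding adj_gen_cov by blast
    then show "(cov_vert (dbeg \<Delta> x) \<one>, cov_vert (dend \<Delta> x) (\<zeta> x)) \<in> (adj cover)\<^sup>*"
      using voltage_closed[OF x] by auto
  qed
  then have "A \<subseteq> stable_elems"
    unfolding A by (intro generate_subgroup_incl subgroup_stable_elems) auto
  moreover have "k \<in> stable_elems" if v: "v \<in> verts \<Delta>" and k: "k \<in> \<omega> (Inl v)" for v k
  proof (rule stable_elemsI[OF T v v])
    show "k \<in> carrier G"
      using v k vertex_weight_closed by blast
    \<comment> \<open>Multiplying the weight of \<open>v\<close> by its own element \<open>k\<close>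
      does not change it, so both vertices coincide and the chain is empty.\<close>
    then show "(cov_vert v \<one>, cov_vert v k) \<in> (adj cover)\<^sup>*"
      using v k by (simp add: coset_join2 vertex_weight subgroup.one_closed)
  qed
  then have "B \<subseteq> stable_elems"
    unfolding B by (intro generate_subgroup_incl subgroup_stable_elems) auto
  ultimately have "generate G (A \<union> B) \<subseteq> stable_elems"
    by (intro generate_subgroup_incl subgroup_stable_elems) auto
  moreover assume "carrier G = generate G (A \<union> B)"
  ultimately have stable: "(cov_vert v \<one>, cov_vert v g) \<in> (adj cover)\<^sup>*"
    if "v \<in> verts \<Delta>" "g \<in> carrier G" for v g
    using that by (auto simp: stable_elems_def)
  show "connected_graph cover"
    unfolding connected_gen_cov_iff
  proof (intro ballI)
    fix v w g h
    assume "v \<in> verts \<Delta>" "w \<in> verts \<Delta>" "g \<in> carrier G" "h \<in> carrier G"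
    \<comment> \<open>The route is from \<open>cov_vert v g\<close> down to
      \<open>cov_vert v \<one>\<close>, along the lifted tree to \<open>cov_vert w \<one>\<close>,
      then up to \<open>cov_vert w h\<close>.\<close>
    then show "(cov_vert v g, cov_vert w h) \<in> (adj cover)\<^sup>*"
      using rtrancl_adj_gen_cov_sym[OF stable] rtrancl_adj_gen_cov_tree[OF T, of v w \<one>] stable
      by (meson one_closed rtrancl_trans)
  qed
qed

end

theorem theorem32:
  fixes \<Delta> T :: "('v, 'd) dart_graph"
    and G :: "('g, 'm) monoid_scheme"
    and \<omega> :: "'v + 'd \<Rightarrow> 'g set"
    and \<zeta> :: "'d \<Rightarrow> 'g"
    and A B :: "'g set"
  assumes "gen_voltage_graph \<Delta> G \<omega> \<zeta>"
    and "spanning_tree T \<Delta>"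
    and "normalised T G \<zeta>"
    and "A = generate G {\<zeta> x | x. x \<in> darts \<Delta> - darts T}"
    and "B = generate G (\<Union>v\<in>verts \<Delta>. \<omega> (Inl v))"
  shows "connected_graph (gen_cov \<Delta> G \<omega> \<zeta>) \<longleftrightarrow> carrier G = generate G (A \<union> B)"
  using gen_voltage_graph.connected_gen_cov_iff_generate[OF assms] .

end
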